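(* Consider the following equations in the unary symbol $'$, the binary symbols $\wedge,\vee$ and (where they occur) the constants $\mathsf T,\mathsf F,\mathsf U$: (1.1a) $x''=x$; (1.1b) $(x\wedge y)'=x'\vee y'$; (1.1d) $x\wedge(y\vee z)=(x\wedge y)\vee(x\wedge z)$; (1.1f) $x\vee(x\wedge y)=x$; (1.1g) $(x\wedge y)\vee(y\wedge x)=(y\wedge x)\vee(x\wedge y)$; (Mem1) $(x\vee y)\wedge z=(x\wedge z)\vee(x'\wedge(y\wedge z))$; (Mem2) $(x\vee y)\wedge z=(x\wedge z)\vee((x'\wedge y)\wedge z)$; (1.4a) $\mathsf U'=\mathsf U$; (1.4b) $\mathsf T\wedge x=x$; (1.4c) $\mathsf T'=\mathsf F$. Then: (i) $\mathrm{CL}$ (no distinguished constants) is completely axiomatised by the five axioms (1.1a), (1.1b), (Mem1), (1.1f), (1.1g), and this group of axioms is independent. (ii) $\mathrm{CL}$ is completely axiomatised by the six axioms (1.1a), (1.1b), (1.1d), (Mem2), (1.1f), (1.1g), and this group of axioms is independent. (iii) $\mathrm{CL}_2$ (only $\mathsf T$ and $\mathsf F$ distinguished) is completely axiomatised by (1.4b), (1.4c) and those in (i), and also by (1.4b), (1.4c) and those in (ii). Each of these groups of axioms is independent. (iv) $\mathrm{CL}^{\mathsf U}$ (only $\mathsf U$ distinguished) is completely axiomatised by (1.4a) and those in (i), and also by (1.4a) and those in (ii). Each of these groups of axioms is independent. (v) $\mathrm{CL}_3$ ($\mathsf T,\mathsf F,\mathsf U$ distinguished) is completely axiomatised by (1.4a),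 (1.4b), (1.4c) and those in (i), and also by (1.4a), (1.4b), (1.4c) and those in (ii). Each of these groups of axioms is independent.
   Context: $\mathrm{CL}$ (conditional logic of Guzmán and Squier) is the equational theory over the signature $\{{}',\wedge,\vee\}$ axiomatised by $x''=x$; $(x\wedge y)'=x'\vee y'$; $(x\wedge y)\wedge z=x\wedge(y\wedge z)$; $x\wedge(y\vee z)=(x\wedge y)\vee(x\wedge z)$; $(x\vee y)\wedge z=(x\wedge z)\vee(x'\wedge y\wedge z)$ (bracketing immaterial by associativity); $x\vee(x\wedge y)=x$; $(x\wedge y)\vee(y\wedge x)=(y\wedge x)\vee(x\wedge y)$. $\mathrm{CL}_2$ is $\mathrm{CL}$ with constants $\mathsf T,\mathsf F$ and the extra axioms $\mathsf T\wedge x=x$, $\mathsf T'=\mathsf F$. $\mathrm{CL}^{\mathsf U}$ is $\mathrm{CL}$ with constant $\mathsf U$ and the extra axiom $\mathsf U'=\mathsf U$. $\mathrm{CL}_3$ is $\mathrm{CL}$ with constants $\mathsf T,\mathsf F,\mathsf U$ and the three extra axioms $\mathsf T\wedge x=x$, $\mathsf T'=\mathsf F$, $\mathsf U'=\mathsf U$. A set $E$ of equations completely axiomatises one of these logics if, over the corresponding signature, exactly the equations of that logic (i.e. the equational consequences of its axioms just listed) are derivable from $E$ in equational logic. (By a theorem of Guzmán and Squier these are exactly the equations valid in the algebra $C=\{\mathsf T,\mathsf F,\mathsf U\}$ with $\mathsf T'=\mathsf F$, $\mathsf F'=\mathsf T$, $\mathsf U'=\mathsf U$; $\mathsf T\wedge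 y=y$, $\mathsf F\wedge y=\mathsf F$, $\mathsf U\wedge y=\mathsf U$; $\mathsf T\vee y=\mathsf T$, $\mathsf F\vee y=y$, $\mathsf U\vee y=\mathsf U$, with the relevant constants distinguished.) A group of axioms is independent if no axiom in it is derivable (in equational logic) from the other axioms of the group. *)

theory Defs
  imports Main
begin

datatype cst = cT | cF | cU

datatype trm =
    Var nat
  | Cst cst
  | Neg trm      ("\<^bold>\<not> _" [80] 80)
  | And trm trm  (infixr "\<^bold>\<and>" 75)
  | Or trm trm   (infixr "\<^bold>\<or>" 70)

type_synonym eqn = "trm \<times> trm"

abbreviation eqn_of :: "trm \<Rightarrow> trm \<Rightarrow> eqn" (infix "\<approx>" 60)
  where "s \<approx> t \<equiv> (s, t)"

primrec csts :: "trm \<Rightarrow> cst set" where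
  "csts (Var n) = {}"
| "csts (Cst c) = {c}"
| "csts (\<^bold>\<not> s) = csts s"
| "csts (s \<^bold>\<and> t) = csts s \<union> csts t"
| "csts (s \<^bold>\<or> t) = csts s \<union> csts t"

text \<open>The set \<open>K\<close> of distinguished constants represents the signature consisting of negation,
  conjunction, disjunction and the constants in \<open>K\<close>. It is a set rather than a type
  because it may be empty.\<close>

definition terms_over :: "cst set \<Rightarrow> trm set"
  where "terms_over K = {s. csts s \<subseteq> K}"

definition eqns_over :: "cst set \<Rightarrow> eqn set"
  where "eqns_over K = terms_over K \<times> terms_over K"

primrec subst :: "(nat \<Rightarrow> trm) \<Rightarrow> trm \<Rightarrow> trm" where
  "subst \<sigma> (Var n) = \<sigma> n"
| "subst \<sigma> (Cst c) = Cst c"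
| "subst \<sigma> (\<^bold>\<not> s) = \<^bold>\<not> subst \<sigma> s"
| "subst \<sigma> (s \<^bold>\<and> t) = subst \<sigma> s \<^bold>\<and> subst \<sigma> t"
| "subst \<sigma> (s \<^bold>\<or> t) = subst \<sigma> s \<^bold>\<or> subst \<sigma> t"

text \<open>Derivability of an equation in equational logic over the signature given by \<open>K\<close>. For
  \<open>E \<subseteq> eqns_over K\<close> all terms occurring in a derivation are over that signature.\<close>

inductive derives :: "cst set \<Rightarrow> eqn set \<Rightarrow> eqn \<Rightarrow> bool"
  for K :: "cst set" and E :: "eqn set" where
  axiom: "e \<in> E \<Longrightarrow> derives K E e"
| refl: "s \<in> terms_over K \<Longrightarrow> derives K E (s \<approx> s)"
| sym: "derives K E (s \<approx> t) \<Longrightarrow> derives K E (t \<approx> s)"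
| trans: "derives K E (s \<approx> t) \<Longrightarrow> derives K E (t \<approx> u) \<Longrightarrow> derives K E (s \<approx> u)"
| subst: "derives K E (s \<approx> t) \<Longrightarrow> (\<And>n. \<sigma> n \<in> terms_over K) \<Longrightarrow>
    derives K E (subst \<sigma> s \<approx> subst \<sigma> t)"
| cong_Neg: "derives K E (s \<approx> t) \<Longrightarrow> derives K E (\<^bold>\<not> s \<approx> \<^bold>\<not> t)"
| cong_And: "derives K E (s \<approx> t) \<Longrightarrow> derives K E (u \<approx> v) \<Longrightarrow>
    derives K E (s \<^bold>\<and> u \<approx> t \<^bold>\<and> v)"
| cong_Or: "derives K E (s \<approx> t) \<Longrightarrow> derives K E (u \<approx> v) \<Longrightarrow>
    derives K E (s \<^bold>\<or> u \<approx> t \<^bold>\<or> v)"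

text \<open>\<open>A\<close> is the set of defining axioms of the logic being axiomatised.\<close>

definition completely_axiomatises :: "cst set \<Rightarrow> eqn set \<Rightarrow> eqn set \<Rightarrow> bool"
  where "completely_axiomatises K A E \<longleftrightarrow>
    E \<subseteq> eqns_over K \<and> (\<forall>e\<in>eqns_over K. derives K E e \<longleftrightarrow> derives K A e)"

definition independent_axioms :: "cst set \<Rightarrow> eqn set \<Rightarrow> bool"
  where "independent_axioms K E \<longleftrightarrow> (\<forall>e\<in>E. \<not> derives K (E - {e}) e)"

abbreviation var_x :: trm ("\<^bold>x") where "\<^bold>x \<equiv> Var 0"
abbreviation var_y :: trm ("\<^bold>y") where "\<^bold>y \<equiv> Var 1"
abbreviation var_z :: trm ("\<^bold>z") where "\<^bold>z \<equiv> Var 2"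

abbreviation true_trm :: trm ("\<^bold>T") where "\<^bold>T \<equiv> Cst cT"
abbreviation false_trm :: trm ("\<^bold>F") where "\<^bold>F \<equiv> Cst cF"
abbreviation undef_trm :: trm ("\<^bold>U") where "\<^bold>U \<equiv> Cst cU"

definition ax_dneg :: eqn
  where "ax_dneg = (\<^bold>\<not> (\<^bold>\<not> \<^bold>x) \<approx> \<^bold>x)"

definition ax_de_morgan :: eqn
  where "ax_de_morgan = (\<^bold>\<not> (\<^bold>x \<^bold>\<and> \<^bold>y) \<approx> (\<^bold>\<not> \<^bold>x) \<^bold>\<or> (\<^bold>\<not> \<^bold>y))"

definition ax_assoc :: eqn
  where "ax_assoc = ((\<^bold>x \<^bold>\<and> \<^bold>y) \<^bold>\<and> \<^bold>z \<approx> \<^bold>x \<^bold>\<and> (\<^bold>y \<^bold>\<and> \<^bold>z))"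

definition ax_distrib :: eqn
  where "ax_distrib = (\<^bold>x \<^bold>\<and> (\<^bold>y \<^bold>\<or> \<^bold>z) \<approx> (\<^bold>x \<^bold>\<and> \<^bold>y) \<^bold>\<or> (\<^bold>x \<^bold>\<and> \<^bold>z))"

definition ax_absorb :: eqn
  where "ax_absorb = (\<^bold>x \<^bold>\<or> (\<^bold>x \<^bold>\<and> \<^bold>y) \<approx> \<^bold>x)"

definition ax_comm :: eqn
  where "ax_comm = ((\<^bold>x \<^bold>\<and> \<^bold>y) \<^bold>\<or> (\<^bold>y \<^bold>\<and> \<^bold>x) \<approx> (\<^bold>y \<^bold>\<and> \<^bold>x) \<^bold>\<or> (\<^bold>x \<^bold>\<and> \<^bold>y))"

definition ax_Mem1 :: eqn
  where "ax_Mem1 =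
    ((\<^bold>x \<^bold>\<or> \<^bold>y) \<^bold>\<and> \<^bold>z \<approx> (\<^bold>x \<^bold>\<and> \<^bold>z) \<^bold>\<or> ((\<^bold>\<not> \<^bold>x) \<^bold>\<and> (\<^bold>y \<^bold>\<and> \<^bold>z)))"

definition ax_Mem2 :: eqn
  where "ax_Mem2 =
    ((\<^bold>x \<^bold>\<or> \<^bold>y) \<^bold>\<and> \<^bold>z \<approx> (\<^bold>x \<^bold>\<and> \<^bold>z) \<^bold>\<or> (((\<^bold>\<not> \<^bold>x) \<^bold>\<and> \<^bold>y) \<^bold>\<and> \<^bold>z))"

definition ax_U :: eqn
  where "ax_U = (\<^bold>\<not> \<^bold>U \<approx> \<^bold>U)"

definition ax_T :: eqn
  where "ax_T = (\<^bold>T \<^bold>\<and> \<^bold>x \<approx> \<^bold>x)"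

definition ax_TF :: eqn
  where "ax_TF = (\<^bold>\<not> \<^bold>T \<approx> \<^bold>F)"

text \<open>The fifth axiom of Guzman and Squier is
  \<open>(x \<^bold>\<or> y) \<^bold>\<and> z \<approx> (x \<^bold>\<and> z) \<^bold>\<or> (\<^bold>\<not> x \<^bold>\<and> y \<^bold>\<and> z)\<close>. Since \<^const>\<open>ax_assoc\<close> is among the axioms, its
  bracketing is immaterial; it is read here with the brackets to the left, as \<^const>\<open>ax_Mem2\<close>.\<close>

definition CL :: "eqn set"
  where "CL = {ax_dneg, ax_de_morgan, ax_assoc, ax_distrib, ax_Mem2, ax_absorb, ax_comm}"

definition CL\<^sub>2 :: "eqn set"
  where "CL\<^sub>2 = CL \<union> {ax_T, ax_TF}"

definition CL\<^sub>U :: "eqn set"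
  where "CL\<^sub>U = CL \<union> {ax_U}"

definition CL\<^sub>3 :: "eqn set"
  where "CL\<^sub>3 = CL \<union> {ax_T, ax_TF, ax_U}"

definition Mem1_group :: "eqn set"
  where "Mem1_group = {ax_dneg, ax_de_morgan, ax_Mem1, ax_absorb, ax_comm}"

definition Mem2_group :: "eqn set"
  where "Mem2_group = {ax_dneg, ax_de_morgan, ax_distrib, ax_Mem2, ax_absorb, ax_comm}"

end

theory Submission
  imports Defs
begin

text \<open>Exchanging conjunction and disjunction maps each group of axioms to a group with the same
  consequences, so every law comes with its dual. For the second group the missing associativity
  is reached from both sides: left distributivity and (Mem2) give
  \<open>(\<not> x \<or> y) \<and> (x \<and> z) = (x \<and> y) \<and> z\<close>, and using this law for \<open>y\<close> and for \<open>y \<and> z\<close> one gets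
  \<open>(x \<and> y) \<and> z = (x \<and> (y \<and> z)) \<and> z = x \<and> (y \<and> z)\<close>. For the first group the decisive law is
  \<open>x \<and> ((\<not> x \<or> y) \<and> z) = x \<and> (y \<and> z)\<close>: a conjunct guarded by \<open>x\<close> may be simplified under the
  assumption that \<open>x\<close> is true. These derivations take place in the term algebra, where equality
  is provability. Independence needs only to be shown for the largest groups, those with all
  three constants, since a smaller group over a smaller signature derives less.\<close>

section \<open>The laws of conditional logic\<close>

locale negation_algebra =
  fixes neg :: "'a \<Rightarrow> 'a" ("\<sim> _" [80] 80)
    and meet :: "'a \<Rightarrow> 'a \<Rightarrow> 'a" (infix "\<sqinter>" 70)
    and join :: "'a \<Rightarrow> 'a \<Rightarrow> 'a" (infix "\<squnion>" 65)
  assumes dneg: "\<sim> (\<sim> x) = x"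
    and de_morgan: "\<sim> (x \<sqinter> y) = \<sim> x \<squnion> \<sim> y"
    and absorb: "x \<squnion> (x \<sqinter> y) = x"
    and comm: "(x \<sqinter> y) \<squnion> (y \<sqinter> x) = (y \<sqinter> x) \<squnion> (x \<sqinter> y)"
begin

lemma neg_join: "\<sim> (x \<squnion> y) = \<sim> x \<sqinter> \<sim> y"
  by (metis dneg de_morgan)

end

subsection \<open>Consequences of (Mem1)\<close>

locale mem1_algebra = negation_algebra +
  assumes mem: "(x \<squnion> y) \<sqinter> z = (x \<sqinter> z) \<squnion> (\<sim> x \<sqinter> (y \<sqinter> z))"

text \<open>Negating an axiom at negated arguments exchanges the connectives. From here on each law
  \<open>l\<close> also yields \<open>dual.l\<close>.\<close>

sublocale mem1_algebra \<subseteq> dual: mem1_algebra neg join meet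
proof unfold_locales
  fix x y z
  show "\<sim> (\<sim> x) = x" by (rule dneg)
  show "\<sim> (x \<squnion> y) = \<sim> x \<sqinter> \<sim> y" by (rule neg_join)
  show "x \<sqinter> (x \<squnion> y) = x" by (metis absorb de_morgan dneg)
  show "(x \<squnion> y) \<sqinter> (y \<squnion> x) = (y \<squnion> x) \<sqinter> (x \<squnion> y)" by (metis comm de_morgan dneg)
  show "(x \<sqinter> y) \<squnion> z = (x \<squnion> z) \<sqinter> (\<sim> x \<squnion> (y \<squnion> z))"
    by (metis mem de_morgan dneg)
qed

section \<open>Idempotence and complement laws\<close>

text \<open>In the names below \<open>zero\<close> and \<open>one\<close> refer to \<open>x \<sqinter> \<sim> x\<close> and \<open>x \<squnion> \<sim> x\<close>, which behave like
  constants only relative to \<open>x\<close>.\<close>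

lemma (in mem1_algebra) meet_idem: "x \<sqinter> x = x"
  by (metis absorb dual.absorb)

lemma (in mem1_algebra) neg_meet_comm: "\<sim> x \<sqinter> x = x \<sqinter> \<sim> x"
proof -
  have "a \<sqinter> (\<sim> a \<squnion> a) = a" for a
    by (metis dual.mem dual.meet_idem meet_idem)
  \<comment> \<open>For p = a \<squnion> \<sim> a and q = \<sim> a \<squnion> a this says p
    \<sqinter> q = p. At \<sim> a it says q \<sqinter> p = q, and the two conjunctions agree by
    \<open>dual.comm\<close>.\<close>
  then have "(a \<squnion> \<sim> a) \<sqinter> (\<sim> a \<squnion> a) = a \<squnion> \<sim> a" for a
    by (metis mem dual.absorb meet_idem)
  then have "\<sim> a \<squnion> a = a \<squnion> \<sim> a" for a
    by (metis dual.comm dneg)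
  then show ?thesis by (metis de_morgan dneg)
qed

lemma (in mem1_algebra) meet_join_meet_self: "x \<sqinter> ((x \<squnion> y) \<sqinter> x) = x"
proof -
  have "(x \<sqinter> z) \<sqinter> ((x \<squnion> y) \<sqinter> z) = x \<sqinter> z" for z
    by (metis mem dual.absorb)
  then show ?thesis by (metis meet_idem)
qed

text \<open>Write f(a) for the left side at a. Since \<sim> f(a) = f(\<sim> a), the law f(a)
  \<squnion> a = a also gives f(a) \<sqinter> a = a. But by dual absorption the first law makes f(a)
  \<sqinter> a equal to f(a).\<close>

lemma (in mem1_algebra) zero_join: "(x \<sqinter> \<sim> x) \<squnion> x = x"
proof -
  have neg_zero_join: "\<sim> ((a \<sqinter> \<sim> a) \<squnion> a) = (\<sim> a \<sqinter> a) \<squnion> \<sim> a" for a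
  proof -
    have "\<sim> ((a \<sqinter> \<sim> a) \<squnion> a) = (\<sim> a \<squnion> a) \<sqinter> \<sim> a"
      by (simp add: dual.de_morgan de_morgan dneg)
    also have "\<dots> = (a \<squnion> \<sim> a) \<sqinter> \<sim> a"
      by (simp add: dual.neg_meet_comm)
    also have "\<dots> = (a \<sqinter> \<sim> a) \<squnion> \<sim> a"
      by (metis mem meet_idem)
    finally show ?thesis by (simp add: neg_meet_comm)
  qed
  have "a \<squnion> ((a \<sqinter> \<sim> a) \<squnion> a) = a" for a
    by (rule dual.meet_join_meet_self)
  moreover have "a \<squnion> ((a \<sqinter> \<sim> a) \<squnion> a) = ((a \<sqinter> \<sim> a) \<squnion> a) \<squnion> a" for a
  proof -
    \<comment> \<open>This is \<open>dual.comm\<close> for \<sim> a and \<sim> a \<sqinter> a, one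
      of whose disjunctions is absorbed to \<sim> a.\<close>
    have "\<sim> a \<sqinter> ((\<sim> a \<sqinter> a) \<squnion> \<sim> a) = ((\<sim> a \<sqinter> a) \<squnion> \<sim> a) \<sqinter> \<sim> a"
      by (metis dual.comm absorb)
    then show ?thesis by (metis neg_zero_join de_morgan dneg)
  qed
  ultimately have *: "((a \<sqinter> \<sim> a) \<squnion> a) \<squnion> a = a" for a
    by simp
  then have "((x \<sqinter> \<sim> x) \<squnion> x) \<sqinter> x = x"
    by (metis neg_zero_join de_morgan dneg)
  then show ?thesis by (metis * dual.absorb)
qed

lemma (in mem1_algebra) neg_meet_join_absorb: "(\<sim> x \<sqinter> (x \<sqinter> y)) \<squnion> x = x"
  by (metis dual.mem dual.meet_join_meet_self dual.neg_meet_comm dual.zero_join dneg)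

text \<open>For b = \<sim> a \<sqinter> (a \<sqinter> y) the first part shows a \<sqinter> b = b.
  Then \<open>mem\<close> splits \<sim> b into \<sim> a \<squnion> a, where y no longer
  occurs.\<close>

lemma (in mem1_algebra) meet_neg_meet: "x \<sqinter> (\<sim> x \<sqinter> y) = x \<sqinter> \<sim> x"
proof -
  have *: "a \<sqinter> (\<sim> a \<sqinter> (a \<sqinter> y)) = \<sim> a \<sqinter> (a \<sqinter> y)" for a
  proof -
    let ?b = "\<sim> a \<sqinter> (a \<sqinter> y)"
    have 1: "?b \<squnion> a = a" by (rule neg_meet_join_absorb)
    have 2: "?b \<sqinter> (a \<sqinter> ?b) = ?b" by (metis 1 meet_join_meet_self)
    have 3: "?b \<squnion> (\<sim> ?b \<sqinter> (a \<sqinter> ?b)) = a \<sqinter> ?b" by (metis 1 mem meet_idem)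
    have 4: "(?b \<squnion> (a \<sqinter> ?b)) \<sqinter> (a \<sqinter> ?b) = a \<sqinter> ?b" by (metis 2 3 mem meet_idem)
    \<comment> \<open>By \<open>mem\<close> for the disjunction of \<sim> a with itself, b
      \<squnion> (a \<sqinter> b) = b. So 4 says b \<sqinter> (a \<sqinter> b) = a \<sqinter> b,
      while 2 says that this is b.\<close>
    show ?thesis by (metis 2 4 mem dneg absorb meet_idem)
  qed
  have "\<sim> a \<sqinter> (a \<sqinter> y) = a \<sqinter> \<sim> a" for a
  proof -
    let ?b = "\<sim> a \<sqinter> (a \<sqinter> y)"
    have b: "\<sim> a \<squnion> \<sim> ?b = \<sim> ?b" by (metis * de_morgan)
    have "\<sim> ?b = (\<sim> a \<squnion> \<sim> ?b) \<sqinter> \<sim> ?b" by (metis b meet_idem)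
    also have "\<dots> = (\<sim> a \<sqinter> \<sim> ?b) \<squnion> (a \<sqinter> \<sim> ?b)" by (metis mem meet_idem dneg)
    also have "\<sim> a \<sqinter> \<sim> ?b = \<sim> a" by (metis b dual.absorb)
    also have "a \<sqinter> \<sim> ?b = a" by (metis de_morgan dneg dual.absorb)
    finally show ?thesis by (metis dual.de_morgan dneg)
  qed
  then show ?thesis by (metis dneg neg_meet_comm)
qed

lemma (in mem1_algebra) meet_join_zero: "(x \<sqinter> y) \<squnion> (x \<sqinter> \<sim> x) = x \<sqinter> y"
  by (metis neg_meet_comm meet_neg_meet dneg dual.meet_idem mem)

text \<open>This is \<open>dual.mem\<close> with last argument x \<sqinter> z, where the first
  factor is absorbed to x. It reduces left distributivity to simplifying under the guard x.\<close>

lemma (in mem1_algebra) meet_neg_join_join_meet: "x \<sqinter> (\<sim> x \<squnion> (y \<squnion> (x \<sqinter> z))) = (x \<sqinter> y) \<squnion> (x \<sqinter> z)"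
  by (metis absorb dual.mem)

lemma (in mem1_algebra) meet_neg_join_meet: "x \<sqinter> (\<sim> x \<squnion> (x \<sqinter> y)) = x \<sqinter> (x \<sqinter> y)"
  by (metis meet_join_zero meet_neg_join_join_meet)

lemma (in mem1_algebra) meet_neg_join_meet_absorb: "x \<sqinter> ((\<sim> x \<squnion> y) \<sqinter> x) = (\<sim> x \<squnion> y) \<sqinter> x"
  by (metis neg_meet_comm meet_neg_meet meet_neg_join_join_meet meet_neg_join_meet dneg mem)

lemma (in mem1_algebra) meet_join_neg_meet: "((x \<sqinter> y) \<squnion> \<sim> x) \<sqinter> x = (x \<sqinter> y) \<sqinter> x"
  by (metis neg_meet_comm zero_join meet_join_zero dual.absorb mem)

section \<open>Repeated conjuncts and left zeros\<close>

lemma (in mem1_algebra) meet_meet_meet_absorb: "x \<sqinter> ((x \<sqinter> y) \<sqinter> x) = (x \<sqinter> y) \<sqinter> x"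
  by (metis meet_neg_join_meet_absorb meet_join_neg_meet dneg dual.meet_neg_join_meet_absorb)

lemma (in mem1_algebra) one_meet_meet: "(x \<squnion> \<sim> x) \<sqinter> (x \<sqinter> y) = x \<sqinter> (x \<sqinter> y)"
  by (metis neg_meet_comm meet_neg_meet meet_join_zero dneg mem)

lemma (in mem1_algebra) one_meet_join: "(x \<squnion> \<sim> x) \<sqinter> (x \<squnion> y) = (\<sim> x \<sqinter> (x \<squnion> y)) \<squnion> x"
  by (metis meet_idem dneg dual.neg_meet_comm dual.absorb mem)

lemma (in mem1_algebra) join_join_join_swap: "x \<squnion> (x \<squnion> (x \<squnion> (y \<squnion> x))) = (\<sim> x \<sqinter> y) \<squnion> x"
  by (metis dneg dual.mem dual.neg_meet_comm dual.meet_neg_join_join_meet meet_neg_join_meet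
      dual.meet_neg_join_meet)

lemma (in mem1_algebra) neg_meet_join_join: "(\<sim> x \<sqinter> (x \<squnion> y)) \<squnion> x = x \<squnion> (x \<squnion> (x \<squnion> y))"
  by (metis dneg de_morgan mem dual.neg_meet_comm meet_join_zero meet_meet_meet_absorb
      one_meet_meet dual.one_meet_join join_join_join_swap dual.join_join_join_swap)

lemma (in mem1_algebra) meet_meet_meet: "x \<sqinter> (x \<sqinter> (x \<sqinter> y)) = (x \<sqinter> y) \<sqinter> x"
  by (metis meet_meet_meet_absorb dual.join_join_join_swap dual.neg_meet_join_join)

lemma (in mem1_algebra) meet_meet_first: "(x \<sqinter> y) \<sqinter> x = x \<sqinter> (x \<sqinter> y)"
  by (metis dneg de_morgan dual.neg_meet_comm dual.meet_join_zero meet_neg_join_meet_absorb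
      dual.meet_meet_meet_absorb one_meet_meet one_meet_join neg_meet_join_join dual.meet_meet_meet)

lemma (in mem1_algebra) neg_meet_meet_meet: "\<sim> (x \<sqinter> (x \<sqinter> y)) \<sqinter> x = \<sim> (x \<sqinter> y) \<sqinter> x"
proof -
  have "x \<sqinter> (x \<sqinter> (w \<sqinter> x)) = (\<sim> x \<squnion> w) \<sqinter> x" for w
    by (metis dual.join_join_join_swap meet_meet_meet meet_meet_first)
  then show ?thesis by (metis meet_neg_join_meet_absorb de_morgan)
qed

lemma (in mem1_algebra) neg_meet_swap_meet: "\<sim> (x \<sqinter> (y \<sqinter> x)) \<sqinter> x = x \<sqinter> (x \<sqinter> \<sim> y)"
proof -
  have "\<sim> (x \<sqinter> (y \<sqinter> x)) \<sqinter> x = \<sim> ((\<sim> x \<squnion> y) \<sqinter> x) \<sqinter> x"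
    by (metis dual.join_join_join_swap meet_meet_meet meet_meet_first neg_meet_meet_meet)
  also have "\<dots> = ((x \<sqinter> \<sim> y) \<squnion> \<sim> x) \<sqinter> x"
    by (metis de_morgan dual.de_morgan dneg)
  finally show ?thesis by (simp add: meet_join_neg_meet meet_meet_first)
qed

text \<open>Used for some w = x \<sqinter> u with \<sim> w \<sqinter> x = x: the instance at w and
  x, together with x \<squnion> w = x, yields w \<sqinter> x = w.\<close>

lemma (in mem1_algebra) meet_neg_meet_join_self: "x \<sqinter> ((\<sim> x \<sqinter> y) \<squnion> x) = x"
  by (metis dual.meet_neg_join_meet_absorb dual.absorb)

lemma (in mem1_algebra) meet_zero_meet: "x \<sqinter> ((x \<sqinter> \<sim> x) \<sqinter> y) = x \<sqinter> \<sim> x" (is "?w = _")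
proof -
  \<comment> \<open>\<open>?q\<close> is the negation of (x \<sqinter> \<sim> x) \<sqinter> y, so
    that \<open>neg_meet_swap_meet\<close> can be applied to it.\<close>
  let ?q = "(x \<squnion> \<sim> x) \<squnion> \<sim> y"
  have "x \<sqinter> (?q \<sqinter> x) = x"
    by (metis mem dual.absorb dual.zero_join)
  then have 1: "x \<sqinter> ?w = x \<sqinter> \<sim> x"
    by (metis neg_meet_swap_meet de_morgan dual.de_morgan dneg neg_meet_comm)
  then have "\<sim> ?w \<sqinter> x = x"
    by (metis neg_meet_meet_meet de_morgan dneg dual.neg_meet_comm dual.zero_join)
  then have "?w \<sqinter> x = ?w"
    by (metis meet_neg_meet_join_self absorb)
  then show ?thesis by (metis 1 meet_meet_first)
qed

lemma (in mem1_algebra) zero_meet: "(x \<sqinter> \<sim> x) \<sqinter> y = x \<sqinter> \<sim> x" (is "?q = ?z")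
proof -
  have "((a \<sqinter> b) \<squnion> a) \<sqinter> b = (a \<sqinter> b) \<sqinter> b" for a b
    by (metis mem meet_join_zero neg_meet_comm)
  from this[of x ?q] have 1: "?z \<sqinter> ?q = ?z"
    by (simp add: meet_zero_meet zero_join)
  have "\<sim> ?z \<sqinter> ?z = ?z"
    by (metis de_morgan mem dneg meet_neg_meet neg_meet_comm dual.meet_idem)
  then have "\<sim> ?q \<sqinter> ?z = ?z"
    by (metis 1 neg_meet_meet_meet)
  then have "?q \<sqinter> ?z = ?q"
    by (metis meet_neg_meet_join_self absorb)
  then show ?thesis by (metis 1 meet_meet_first)
qed

text \<open>Let z = x \<sqinter> \<sim> x. As z \<squnion> x = x and z is a left zero,
  \<open>mem\<close> writes x \<sqinter> y as z \<squnion> w. The earlier laws turn x \<sqinter> (x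
  \<sqinter> y) into z \<squnion> (z \<squnion> w) = (z \<squnion> w) \<squnion> z, and
  \<open>meet_join_zero\<close> removes the last z.\<close>

lemma (in mem1_algebra) meet_left_idem: "x \<sqinter> (x \<sqinter> y) = x \<sqinter> y"
  by (metis mem zero_join meet_join_zero dual.one_meet_join dual.neg_meet_join_join
      meet_meet_meet meet_meet_first dual.meet_meet_first zero_meet)

lemma (in mem1_algebra) zero_join_meet: "(x \<sqinter> \<sim> x) \<squnion> (x \<sqinter> y) = x \<sqinter> y"
  by (metis dual.one_meet_join dual.neg_meet_join_join meet_left_idem)

lemma (in mem1_algebra) meet_first_idem: "(x \<sqinter> y) \<sqinter> x = x \<sqinter> y"
  by (metis meet_meet_first meet_left_idem)

lemma (in mem1_algebra) meet_meet_swap: "x \<sqinter> (y \<sqinter> x) = (\<sim> x \<squnion> y) \<sqinter> x"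
  by (metis dual.join_join_join_swap meet_left_idem)

lemma (in mem1_algebra) meet_neg_join_comm: "x \<sqinter> (\<sim> x \<squnion> y) = (\<sim> x \<squnion> y) \<sqinter> x"
  by (metis dneg dual.de_morgan meet_neg_join_meet dual.meet_left_idem dual.meet_first_idem
      meet_meet_swap)

lemma (in mem1_algebra) join_meet_last: "(x \<squnion> y) \<sqinter> y = (x \<squnion> \<sim> x) \<sqinter> y"
  by (metis mem meet_idem meet_left_idem)

lemma (in mem1_algebra) neg_meet_join_last: "(\<sim> x \<sqinter> y) \<squnion> y = (x \<sqinter> y) \<squnion> y"
  by (metis join_meet_last dneg dual.neg_meet_comm dual.de_morgan)

lemma (in mem1_algebra) neg_meet_join_meet_last: "(\<sim> x \<sqinter> y) \<squnion> (x \<sqinter> y) = (x \<squnion> y) \<sqinter> y"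
  by (metis dneg mem meet_idem dual.neg_meet_join_last)

lemma (in mem1_algebra) meet_one_meet: "x \<sqinter> ((x \<squnion> \<sim> x) \<sqinter> y) = x \<sqinter> y"
proof -
  have *: "x \<sqinter> (((x \<squnion> \<sim> x) \<sqinter> w) \<sqinter> x) = x \<sqinter> w" for w
    by (metis neg_meet_join_meet_last join_meet_last meet_neg_meet zero_join_meet
        meet_neg_join_join_meet meet_meet_swap meet_neg_join_comm)
  then show ?thesis by (metis meet_left_idem)
qed

lemma (in mem1_algebra) meet_join_meet_last: "((x \<sqinter> y) \<squnion> y) \<sqinter> y = (x \<squnion> \<sim> x) \<sqinter> y"
proof -
  have "((x \<sqinter> y) \<squnion> y) \<sqinter> y = ((x \<sqinter> \<sim> x) \<squnion> y) \<sqinter> y"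
    by (metis dual.join_meet_last)
  also have "\<dots> = ((x \<sqinter> \<sim> x) \<squnion> \<sim> (x \<sqinter> \<sim> x)) \<sqinter> y"
    by (rule join_meet_last)
  also have "\<sim> (x \<sqinter> \<sim> x) = x \<squnion> \<sim> x"
    by (metis de_morgan dneg dual.neg_meet_comm)
  also have "(x \<sqinter> \<sim> x) \<squnion> (x \<squnion> \<sim> x) = x \<squnion> \<sim> x"
    by (metis dual.one_meet_meet dual.meet_left_idem)
  finally show ?thesis .
qed

text \<open>Let c = x \<sqinter> y. By \<open>mem\<close> and dual absorption, c \<sqinter> ((x
  \<squnion> \<sim> x) \<sqinter> y) = c. The second conjunct equals (c \<squnion> \<sim> c)
  \<sqinter> y, and \<open>meet_one_meet\<close> at c reduces it to y.\<close>

lemma (in mem1_algebra) meet_last_idem: "(x \<sqinter> y) \<sqinter> y = x \<sqinter> y"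
  by (metis dual.absorb mem meet_join_meet_last meet_one_meet join_meet_last)

section \<open>Simplification under a guard\<close>

lemma (in mem1_algebra) join_neg_meet: "x \<squnion> (\<sim> x \<sqinter> y) = x \<squnion> (y \<squnion> x)"
  by (metis dual.meet_meet_swap dual.meet_neg_join_comm)

lemma (in mem1_algebra) meet_neg_join_swap: "x \<sqinter> (\<sim> x \<squnion> y) = x \<sqinter> (y \<sqinter> x)"
  by (metis meet_meet_swap meet_neg_join_comm)

lemma (in mem1_algebra) join_meet_neg: "x \<squnion> (y \<sqinter> \<sim> x) = x \<squnion> y"
  by (metis meet_meet_swap meet_neg_join_comm meet_last_idem dneg dual.meet_left_idem
      dual.meet_first_idem dual.meet_meet_swap)

lemma (in mem1_algebra) meet_join_join_last: "(x \<sqinter> (y \<squnion> z)) \<squnion> z = (x \<sqinter> y) \<squnion> z"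
  by (metis dual.mem dual.meet_last_idem)

lemma (in mem1_algebra) meet_meet_join_neg: "x \<sqinter> (y \<sqinter> (z \<squnion> \<sim> x)) = x \<sqinter> (y \<sqinter> z)"
  by (metis meet_join_join_last dual.join_meet_neg)

lemma (in mem1_algebra) neg_join_meet_meet: "(\<sim> x \<squnion> y) \<sqinter> (x \<sqinter> z) = x \<sqinter> (y \<sqinter> (x \<sqinter> z))"
  by (metis neg_meet_comm zero_join_meet meet_neg_meet dneg mem)

lemma (in mem1_algebra) meet_join_meet_meet: "x \<sqinter> ((x \<squnion> y) \<sqinter> (x \<sqinter> z)) = x \<sqinter> z"
  by (metis meet_left_idem meet_neg_meet dneg dual.neg_join_meet_meet dual.de_morgan)

lemma (in mem1_algebra) meet_join_neg_join: "x \<sqinter> (y \<squnion> \<sim> (x \<squnion> z)) = x \<sqinter> y"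
  by (metis meet_meet_join_neg meet_join_meet_meet)

lemma (in mem1_algebra) meet_join_neg_meet_absorb: "x \<sqinter> (y \<squnion> (\<sim> x \<sqinter> z)) = x \<sqinter> y"
  by (metis meet_join_neg_join dneg dual.de_morgan)

lemma (in mem1_algebra) meet_join_meet_absorb: "x \<sqinter> ((x \<squnion> y) \<sqinter> z) = x \<sqinter> z"
  by (metis mem meet_left_idem meet_join_neg_meet_absorb)

lemma (in mem1_algebra) meet_join_neg_meet_first: "x \<sqinter> ((y \<squnion> \<sim> x) \<sqinter> x) = x \<sqinter> y"
  by (metis join_neg_meet meet_neg_join_swap meet_neg_join_meet meet_left_idem dneg)

lemma (in mem1_algebra) join_meet_join: "x \<squnion> ((y \<sqinter> z) \<squnion> x) = x \<squnion> ((x \<squnion> y) \<sqinter> z)"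
  by (metis join_neg_meet mem dual.meet_join_meet_absorb)

lemma (in mem1_algebra) join_meet_join_join: "x \<squnion> (((x \<sqinter> y) \<squnion> z) \<squnion> x) = x \<squnion> z"
  by (metis join_meet_join dual.mem dual.meet_left_idem dual.meet_join_meet_absorb)

lemma (in mem1_algebra) meet_neg_meet_join: "x \<sqinter> ((\<sim> x \<sqinter> y) \<squnion> z) = x \<sqinter> (z \<sqinter> x)"
  by (metis meet_join_neg_meet_first join_meet_join_join meet_neg_join_swap)

text \<open>After \<open>mem\<close>, the second conjunct is a disjunction of \<sim> x \<sqinter> z
  and x \<sqinter> (y \<sqinter> z). The guard x discards the first disjunct by
  \<open>meet_neg_meet_join\<close>.\<close>

lemma (in mem1_algebra) meet_neg_join_meet_cancel: "x \<sqinter> ((\<sim> x \<squnion> y) \<sqinter> z) = x \<sqinter> (y \<sqinter> z)"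
  by (metis meet_neg_meet_join mem dneg meet_first_idem meet_left_idem)

lemma (in mem1_algebra) meet_meet_swap_meet: "x \<sqinter> ((y \<sqinter> x) \<sqinter> z) = x \<sqinter> (y \<sqinter> z)"
  by (metis meet_neg_join_meet_cancel dneg join_meet_neg)

lemma (in mem1_algebra) meet_meet_cancel: "x \<sqinter> (y \<sqinter> x) = x \<sqinter> y"
  by (metis meet_meet_swap_meet meet_first_idem meet_idem)

lemma (in mem1_algebra) meet_neg_join: "x \<sqinter> (\<sim> x \<squnion> y) = x \<sqinter> y"
  by (metis meet_meet_swap meet_neg_join_comm meet_meet_cancel)

lemma (in mem1_algebra) meet_meet_meet_cancel: "x \<sqinter> ((x \<sqinter> y) \<sqinter> z) = x \<sqinter> (y \<sqinter> z)"
  by (metis meet_neg_join_meet_cancel dual.meet_neg_join dneg)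

section \<open>Distributivity and associativity\<close>

lemma (in mem1_algebra) meet_meet_last: "(x \<sqinter> y) \<sqinter> (y \<sqinter> z) = (x \<sqinter> y) \<sqinter> z"
  by (metis meet_left_idem meet_last_idem meet_meet_meet_cancel)

lemma (in mem1_algebra) meet_meet_meet_first: "(x \<sqinter> y) \<sqinter> (x \<sqinter> z) = (x \<sqinter> y) \<sqinter> z"
  by (metis meet_first_idem meet_meet_last)

lemma (in mem1_algebra) meet_meet_neg_join: "(x \<sqinter> y) \<sqinter> (\<sim> x \<squnion> z) = (x \<sqinter> y) \<sqinter> z"
  by (metis meet_neg_join meet_meet_meet_first)

lemma (in mem1_algebra) join_neg_meet_meet: "x \<squnion> ((\<sim> x \<sqinter> y) \<sqinter> z) = x \<squnion> (y \<sqinter> z)"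
  by (metis dual.meet_neg_join meet_meet_meet_cancel)

text \<open>The right side is x \<sqinter> (y \<squnion> (x \<sqinter> z)). Under the guard x one
  may replace y by \<sim> x \<squnion> y, after which x \<sqinter> z shrinks to z, and then restore
  y.\<close>

lemma (in mem1_algebra) distrib: "x \<sqinter> (y \<squnion> z) = (x \<sqinter> y) \<squnion> (x \<sqinter> z)"
  by (metis meet_neg_join_join_meet meet_neg_join dual.meet_meet_neg_join dual.join_neg_meet_meet
      dneg)

lemma (in mem1_algebra) join_meet_first_meet: "((x \<squnion> y) \<sqinter> x) \<sqinter> z = (x \<squnion> y) \<sqinter> (x \<sqinter> z)"
  by (metis dual.meet_join_join_last meet_meet_last dual.distrib absorb)

lemma (in mem1_algebra) neg_join_meet_meet_cancel: "(\<sim> x \<squnion> y) \<sqinter> ((x \<sqinter> y) \<sqinter> z) = (\<sim> x \<squnion> y) \<sqinter> (x \<sqinter> z)"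
  by (metis meet_meet_swap meet_meet_cancel meet_meet_meet_cancel)

text \<open>Let g = \<sim> x \<squnion> y, which is also (x \<sqinter> y) \<squnion> \<sim> x. As g
  \<sqinter> (x \<sqinter> y) = x \<sqinter> y, the two preceding lemmas make (x \<sqinter> y)
  \<sqinter> z equal to g \<sqinter> (x \<sqinter> z) = x \<sqinter> (y \<sqinter> (x \<sqinter>
  z)). So a further guard x changes nothing, and under it \<open>meet_meet_meet_cancel\<close>
  applies.\<close>

lemma (in mem1_algebra) assoc: "(x \<sqinter> y) \<sqinter> z = x \<sqinter> (y \<sqinter> z)"
  by (metis dneg dual.meet_meet_swap neg_join_meet_meet meet_meet_cancel dual.meet_meet_cancel
      meet_meet_meet_cancel join_meet_first_meet neg_join_meet_meet_cancel)

lemma (in mem1_algebra) Mem2: "(x \<squnion> y) \<sqinter> z = (x \<sqinter> z) \<squnion> ((\<sim> x \<sqinter> y) \<sqinter> z)"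
  by (simp add: mem assoc)

subsection \<open>Consequences of (Mem2)\<close>

locale mem2_algebra = negation_algebra +
  assumes distrib: "x \<sqinter> (y \<squnion> z) = (x \<sqinter> y) \<squnion> (x \<sqinter> z)"
    and mem: "(x \<squnion> y) \<sqinter> z = (x \<sqinter> z) \<squnion> ((\<sim> x \<sqinter> y) \<sqinter> z)"

sublocale mem2_algebra \<subseteq> dual: mem2_algebra neg join meet
proof unfold_locales
  fix x y z
  show "\<sim> (\<sim> x) = x" by (rule dneg)
  show "\<sim> (x \<squnion> y) = \<sim> x \<sqinter> \<sim> y" by (rule neg_join)
  show "x \<sqinter> (x \<squnion> y) = x" by (metis absorb de_morgan dneg)
  show "(x \<squnion> y) \<sqinter> (y \<squnion> x) = (y \<squnion> x) \<sqinter> (x \<squnion> y)" by (metis comm de_morgan dneg)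
  show "x \<squnion> (y \<sqinter> z) = (x \<squnion> y) \<sqinter> (x \<squnion> z)" by (metis distrib de_morgan dneg)
  show "(x \<sqinter> y) \<squnion> z = (x \<squnion> z) \<sqinter> ((\<sim> x \<squnion> y) \<squnion> z)"
    by (metis mem de_morgan dneg)
qed

section \<open>Complement laws and idempotence\<close>

lemma (in mem2_algebra) meet_idem: "x \<sqinter> x = x"
  by (metis absorb dual.absorb)

lemma (in mem2_algebra) nested_absorb: "x \<squnion> ((x \<sqinter> y) \<sqinter> z) = x"
  by (metis dual.distrib absorb dual.absorb)

lemma (in mem2_algebra) join_meet_left: "(x \<squnion> y) \<sqinter> x = x \<squnion> (y \<sqinter> x)"
  by (metis dual.distrib dual.meet_idem)

lemma (in mem2_algebra) neg_meet_right_absorb: "(\<sim> x \<sqinter> x) \<sqinter> \<sim> x = \<sim> x \<sqinter> x"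
proof -
  have A: "(a \<squnion> (\<sim> a \<sqinter> b)) \<sqinter> a = (a \<squnion> b) \<sqinter> a" for a b
    by (metis mem join_meet_left meet_idem)
  have B: "((a \<squnion> \<sim> a) \<sqinter> a) \<sqinter> a = a" for a
    by (metis A join_meet_left meet_idem dual.meet_idem)
  \<comment> \<open>This is B negated. It exhibits \<sim> x in the shape that
    \<open>dual.nested_absorb\<close> absorbs into \<sim> x \<sqinter> x.\<close>
  have "((\<sim> x \<sqinter> x) \<squnion> \<sim> x) \<squnion> \<sim> x = \<sim> x"
    by (metis B de_morgan dneg)
  then show ?thesis by (metis dual.nested_absorb)
qed

text \<open>For the two orders p and q of the conjunction, p \<squnion> q = p and by symmetry q
  \<squnion> p = q, while \<open>comm\<close> identifies the two disjunctions.\<close>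

lemma (in mem2_algebra) neg_meet_comm: "\<sim> x \<sqinter> x = x \<sqinter> \<sim> x"
proof -
  have "(a \<sqinter> \<sim> a) \<squnion> (\<sim> a \<sqinter> a) = a \<sqinter> \<sim> a" for a
    by (metis neg_meet_right_absorb mem dual.meet_idem)
  then show ?thesis by (metis comm dneg)
qed

lemma (in mem2_algebra) zero_join: "(x \<sqinter> \<sim> x) \<squnion> x = x"
  by (metis meet_idem distrib dual.neg_meet_comm dual.absorb)

lemma (in mem2_algebra) meet_join_neg_meet: "(x \<sqinter> y) \<squnion> (\<sim> x \<sqinter> y) = (x \<squnion> \<sim> x) \<sqinter> y"
  by (metis mem meet_idem)

lemma (in mem2_algebra) meet_neg_meet: "x \<sqinter> (\<sim> x \<sqinter> y) = x \<sqinter> \<sim> x"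
  by (metis dneg mem dual.de_morgan dual.distrib dual.absorb meet_idem)

lemma (in mem2_algebra) meet_join_zero: "(x \<sqinter> y) \<squnion> (x \<sqinter> \<sim> x) = x \<sqinter> y"
  by (metis meet_join_neg_meet meet_neg_meet absorb distrib dneg dual.meet_idem
      dual.neg_meet_comm dual.zero_join dual.meet_neg_meet dual.de_morgan dual.mem mem)

lemma (in mem2_algebra) meet_join_neg: "x \<sqinter> (y \<squnion> \<sim> x) = x \<sqinter> y"
  by (metis meet_join_zero distrib)

lemma (in mem2_algebra) meet_meet_one: "(x \<sqinter> y) \<sqinter> (x \<squnion> \<sim> x) = (x \<sqinter> y) \<sqinter> x"
  by (metis meet_join_neg meet_neg_meet dneg de_morgan dual.neg_meet_comm)

lemma (in mem2_algebra) join_neg_meet: "x \<squnion> (\<sim> x \<sqinter> y) = x \<squnion> y"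
proof -
  have "x \<squnion> y = (x \<squnion> y) \<sqinter> (x \<squnion> \<sim> x)"
    by (metis dual.meet_join_zero)
  also have "\<dots> = x \<squnion> ((\<sim> x \<sqinter> y) \<sqinter> \<sim> x)"
    by (metis mem dual.absorb meet_meet_one dneg dual.neg_meet_comm)
  also have "\<dots> = x \<squnion> (\<sim> x \<sqinter> y)"
    by (metis dual.meet_join_neg)
  finally show ?thesis by simp
qed

lemma (in mem2_algebra) meet_left_idem: "x \<sqinter> (x \<sqinter> y) = x \<sqinter> y"
  by (metis dual.join_neg_meet join_neg_meet dneg)

text \<open>Take \<open>comm\<close> for x and c = x \<sqinter> y. One side is c \<squnion> (c
  \<sqinter> x) = c, the other is (c \<sqinter> x) \<squnion> c = c \<sqinter> (x \<squnion> c) = c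
  \<sqinter> x.\<close>

lemma (in mem2_algebra) meet_first_idem: "(x \<sqinter> y) \<sqinter> x = x \<sqinter> y"
  by (metis comm meet_left_idem absorb distrib meet_idem)

lemma (in mem2_algebra) meet_last_idem: "(x \<sqinter> y) \<sqinter> y = x \<sqinter> y"
  by (metis distrib dneg join_neg_meet dual.join_neg_meet dual.meet_first_idem dual.de_morgan)

section \<open>Cancellation and associativity\<close>

lemma (in mem2_algebra) meet_meet_meet_cancel: "x \<sqinter> ((x \<sqinter> y) \<sqinter> z) = x \<sqinter> (y \<sqinter> z)"
  by (metis dual.join_neg_meet de_morgan distrib dneg)

lemma (in mem2_algebra) meet_meet_last: "(x \<sqinter> y) \<sqinter> (y \<sqinter> z) = (x \<sqinter> y) \<sqinter> z"
  by (metis meet_left_idem meet_last_idem meet_meet_meet_cancel)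

lemma (in mem2_algebra) meet_meet_meet_first: "(x \<sqinter> y) \<sqinter> (x \<sqinter> z) = (x \<sqinter> y) \<sqinter> z"
  by (metis meet_first_idem meet_meet_last)

lemma (in mem2_algebra) meet_meet_meet_last: "(x \<sqinter> (y \<sqinter> z)) \<sqinter> z = x \<sqinter> (y \<sqinter> z)"
  by (metis meet_meet_last meet_last_idem)

lemma (in mem2_algebra) meet_join_join_meet: "(x \<sqinter> y) \<squnion> ((x \<squnion> z) \<sqinter> y) = (x \<squnion> z) \<sqinter> y"
  by (metis dual.meet_left_idem mem)

lemma (in mem2_algebra) meet_join_join_last: "(x \<sqinter> (y \<squnion> z)) \<squnion> z = (x \<sqinter> y) \<squnion> z"
proof -
  have "x \<sqinter> ((\<sim> x \<squnion> y) \<squnion> z) = x \<sqinter> (y \<squnion> z)"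
    by (metis distrib dual.join_neg_meet)
  then have "(x \<sqinter> (y \<squnion> z)) \<squnion> ((x \<sqinter> y) \<squnion> z) = (x \<sqinter> y) \<squnion> z"
    by (metis meet_join_join_meet dual.mem)
  then show ?thesis by (metis distrib dual.meet_meet_meet_first)
qed

lemma (in mem2_algebra) meet_join_meet_last: "(x \<sqinter> y) \<squnion> (z \<sqinter> y) = ((x \<sqinter> y) \<squnion> z) \<sqinter> y"
  by (metis meet_join_join_meet meet_last_idem dual.distrib dual.meet_left_idem)

lemma (in mem2_algebra) neg_join_meet_meet: "(\<sim> x \<squnion> y) \<sqinter> (x \<sqinter> z) = (x \<sqinter> y) \<sqinter> z"
proof -
  have "(\<sim> x \<squnion> y) \<sqinter> (x \<sqinter> z) = ((\<sim> x \<sqinter> (x \<sqinter> z)) \<squnion> (x \<sqinter> y)) \<sqinter> (x \<sqinter> z)"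
    by (metis mem meet_join_meet_last dneg)
  \<comment> \<open>The first disjunct collapses to x \<sqinter> \<sim> x, and (x \<sqinter> \<sim>
    x) \<squnion> (x \<sqinter> y) = x \<sqinter> (\<sim> x \<squnion> y) = x \<sqinter> y.\<close>
  also have "\<dots> = (x \<sqinter> y) \<sqinter> (x \<sqinter> z)"
    by (metis meet_neg_meet dneg neg_meet_comm distrib dual.join_neg_meet)
  finally show ?thesis by (simp add: meet_meet_meet_first)
qed

lemma (in mem2_algebra) assoc: "(x \<sqinter> y) \<sqinter> z = x \<sqinter> (y \<sqinter> z)"
proof -
  have "(x \<sqinter> y) \<sqinter> z = (\<sim> x \<squnion> y) \<sqinter> (x \<sqinter> z)"
    by (simp add: neg_join_meet_meet)
  also have "\<dots> = (\<sim> x \<squnion> (y \<sqinter> (x \<sqinter> z))) \<sqinter> (x \<sqinter> z)"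
    by (metis dual.meet_join_join_last)
  also have "\<sim> x \<squnion> (y \<sqinter> (x \<sqinter> z)) = \<sim> x \<squnion> (y \<sqinter> z)"
    by (metis dual.distrib join_neg_meet dneg)
  also have "(\<sim> x \<squnion> (y \<sqinter> z)) \<sqinter> (x \<sqinter> z) = (x \<sqinter> (y \<sqinter> z)) \<sqinter> z"
    by (rule neg_join_meet_meet)
  also have "\<dots> = x \<sqinter> (y \<sqinter> z)"
    by (rule meet_meet_meet_last)
  finally show ?thesis .
qed

section \<open>Algebras of terms\<close>

primrec eval :: "('a \<Rightarrow> 'a) \<Rightarrow> ('a \<Rightarrow> 'a \<Rightarrow> 'a) \<Rightarrow> ('a \<Rightarrow> 'a \<Rightarrow> 'a) \<Rightarrow> (cst \<Rightarrow> 'a) \<Rightarrow> (nat \<Rightarrow> 'a) \<Rightarrow> trm \<Rightarrow> 'a" where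
  "eval neg meet join k \<rho> (Var n) = \<rho> n"
| "eval neg meet join k \<rho> (Cst c) = k c"
| "eval neg meet join k \<rho> (\<^bold>\<not> s) = neg (eval neg meet join k \<rho> s)"
| "eval neg meet join k \<rho> (s \<^bold>\<and> t) = meet (eval neg meet join k \<rho> s) (eval neg meet join k \<rho> t)"
| "eval neg meet join k \<rho> (s \<^bold>\<or> t) = join (eval neg meet join k \<rho> s) (eval neg meet join k \<rho> t)"

definition holds :: "('a \<Rightarrow> 'a) \<Rightarrow> ('a \<Rightarrow> 'a \<Rightarrow> 'a) \<Rightarrow> ('a \<Rightarrow> 'a \<Rightarrow> 'a) \<Rightarrow> (cst \<Rightarrow> 'a) \<Rightarrow> eqn \<Rightarrow> bool" where
  "holds neg meet join k e \<longleftrightarrow>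
    (\<forall>\<rho>. eval neg meet join k \<rho> (fst e) = eval neg meet join k \<rho> (snd e))"

text \<open>The axioms mention only the variables 0, 1 and 2, so this turns \<open>holds\<close> of
  an axiom into an ordinary identity.\<close>

lemma all_valuation_iff:
  "(\<forall>\<rho> :: nat \<Rightarrow> 'a. P (\<rho> 0) (\<rho> 1) (\<rho> 2)) \<longleftrightarrow> (\<forall>x y z. P x y z)"
proof (intro iffI allI)
  fix x y z :: 'a assume "\<forall>\<rho> :: nat \<Rightarrow> 'a. P (\<rho> 0) (\<rho> 1) (\<rho> 2)"
  from this[THEN spec, of "(!) [x, y, z]"] show "P x y z"
    by (simp add: numeral_2_eq_2)
qed simp

lemma holds_axiom_iff:
  "holds neg meet join k ax_dneg \<longleftrightarrow> (\<forall>x. neg (neg x) = x)"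
  "holds neg meet join k ax_de_morgan \<longleftrightarrow> (\<forall>x y. neg (meet x y) = join (neg x) (neg y))"
  "holds neg meet join k ax_assoc \<longleftrightarrow> (\<forall>x y z. meet (meet x y) z = meet x (meet y z))"
  "holds neg meet join k ax_distrib \<longleftrightarrow>
    (\<forall>x y z. meet x (join y z) = join (meet x y) (meet x z))"
  "holds neg meet join k ax_absorb \<longleftrightarrow> (\<forall>x y. join x (meet x y) = x)"
  "holds neg meet join k ax_comm \<longleftrightarrow>
    (\<forall>x y. join (meet x y) (meet y x) = join (meet y x) (meet x y))"
  "holds neg meet join k ax_Mem1 \<longleftrightarrow>
    (\<forall>x y z. meet (join x y) z = join (meet x z) (meet (neg x) (meet y z)))"
  "holds neg meet join k ax_Mem2 \<longleftrightarrow>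
    (\<forall>x y z. meet (join x y) z = join (meet x z) (meet (meet (neg x) y) z))"
  "holds neg meet join k ax_U \<longleftrightarrow> neg (k cU) = k cU"
  "holds neg meet join k ax_T \<longleftrightarrow> (\<forall>x. meet (k cT) x = x)"
  "holds neg meet join k ax_TF \<longleftrightarrow> neg (k cT) = k cF"
proof -
  show "holds neg meet join k ax_dneg \<longleftrightarrow> (\<forall>x. neg (neg x) = x)"
    using all_valuation_iff[of "\<lambda>x _ _. neg (neg x) = x"] by (simp add: holds_def ax_dneg_def)
  show "holds neg meet join k ax_de_morgan \<longleftrightarrow> (\<forall>x y. neg (meet x y) = join (neg x) (neg y))"
    using all_valuation_iff[of "\<lambda>x y _. neg (meet x y) = join (neg x) (neg y)"]
    by (simp add: holds_def ax_de_morgan_def)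
  show "holds neg meet join k ax_assoc \<longleftrightarrow> (\<forall>x y z. meet (meet x y) z = meet x (meet y z))"
    using all_valuation_iff[of "\<lambda>x y z. meet (meet x y) z = meet x (meet y z)"]
    by (simp add: holds_def ax_assoc_def)
  show "holds neg meet join k ax_distrib \<longleftrightarrow>
      (\<forall>x y z. meet x (join y z) = join (meet x y) (meet x z))"
    using all_valuation_iff[of "\<lambda>x y z. meet x (join y z) = join (meet x y) (meet x z)"]
    by (simp add: holds_def ax_distrib_def)
  show "holds neg meet join k ax_absorb \<longleftrightarrow> (\<forall>x y. join x (meet x y) = x)"
    using all_valuation_iff[of "\<lambda>x y _. join x (meet x y) = x"]
    by (simp add: holds_def ax_absorb_def)
  show "holds neg meet join k ax_comm \<longleftrightarrow>
      (\<forall>x y. join (meet x y) (meet y x) = join (meet y x) (meet x y))"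
    using all_valuation_iff[of "\<lambda>x y _. join (meet x y) (meet y x) = join (meet y x) (meet x y)"]
    by (simp add: holds_def ax_comm_def)
  show "holds neg meet join k ax_Mem1 \<longleftrightarrow>
      (\<forall>x y z. meet (join x y) z = join (meet x z) (meet (neg x) (meet y z)))"
    using all_valuation_iff
      [of "\<lambda>x y z. meet (join x y) z = join (meet x z) (meet (neg x) (meet y z))"]
    by (simp add: holds_def ax_Mem1_def)
  show "holds neg meet join k ax_Mem2 \<longleftrightarrow>
      (\<forall>x y z. meet (join x y) z = join (meet x z) (meet (meet (neg x) y) z))"
    using all_valuation_iff
      [of "\<lambda>x y z. meet (join x y) z = join (meet x z) (meet (meet (neg x) y) z)"]
    by (simp add: holds_def ax_Mem2_def)
  show "holds neg meet join k ax_T \<longleftrightarrow> (\<forall>x. meet (k cT) x = x)"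
    using all_valuation_iff[of "\<lambda>x _ _. meet (k cT) x = x"] by (simp add: holds_def ax_T_def)
qed (simp_all add: holds_def ax_U_def ax_TF_def)

section \<open>Soundness, cut and completeness of equational logic\<close>

lemma eval_subst:
  "eval neg meet join k \<rho> (subst \<sigma> t) = eval neg meet join k (\<lambda>n. eval neg meet join k \<rho> (\<sigma> n)) t"
  by (induction t) auto

lemma soundness:
  assumes "derives K E e" and "\<forall>a\<in>E. holds neg meet join k a"
  shows "holds neg meet join k e"
  using assms(1)
proof (induction rule: derives.induct)
  case (axiom e)
  with assms(2) show ?case by blast
qed (simp_all add: holds_def eval_subst)

lemma terms_over_mono: "K \<subseteq> K' \<Longrightarrow> terms_over K \<subseteq> terms_over K'"
  by (auto simp: terms_over_def)

text \<open>Only reflexivity and substitution refer to the signature, and a larger one admits more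
  terms there.\<close>

lemma derives_cut:
  assumes "derives K E e" and "K \<subseteq> K'" and "\<forall>a\<in>E. derives K' E' a"
  shows "derives K' E' e"
  using assms(1)
proof (induction rule: derives.induct)
  case (subst s t \<sigma>)
  then show ?case using terms_over_mono[OF assms(2)] by (meson derives.subst subsetD)
qed (use assms terms_over_mono[OF assms(2)] in \<open>auto intro: derives.intros\<close>)

lemma derives_mono: "derives K E e \<Longrightarrow> K \<subseteq> K' \<Longrightarrow> E \<subseteq> E' \<Longrightarrow> derives K' E' e"
  by (rule derives_cut) (auto intro: derives.axiom)

lemma csts_subst: "csts (subst \<sigma> t) \<subseteq> csts t \<union> (\<Union>n. csts (\<sigma> n))"
  by (induction t) auto

lemma subst_in_terms_over:
  "t \<in> terms_over K \<Longrightarrow> (\<And>n. \<sigma> n \<in> terms_over K) \<Longrightarrow> subst \<sigma> t \<in> terms_over K"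
  using csts_subst[of \<sigma> t] by (fastforce simp: terms_over_def)

lemma subst_Var: "subst Var t = t"
  by (induction t) auto

lemma derives_subst_cong:
  assumes "\<And>n. derives K E (\<sigma> n \<approx> \<tau> n)" and "t \<in> terms_over K"
  shows "derives K E (subst \<sigma> t \<approx> subst \<tau> t)"
  using assms(2)
  by (induction t) (auto simp: terms_over_def intro: assms(1) derives.intros)

lemma provable_class_eq_iff:
  assumes "t \<in> terms_over K"
  shows "{u. derives K E (s \<approx> u)} = {u. derives K E (t \<approx> u)} \<longleftrightarrow> derives K E (s \<approx> t)"
  using assms by (auto intro: derives.refl derives.sym derives.trans)

text \<open>Birkhoff's theorem. The quotient of the terms by provable equality has to be supplied as
  a type, since HOL cannot form a type from the parameters \<open>K\<close> and \<open>E\<close>.\<close>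

lemma term_algebra:
  fixes Abs :: "trm set \<Rightarrow> 'a"
  assumes "type_definition Rep Abs ((\<lambda>s. {t. derives K E (s \<approx> t)}) ` terms_over K)"
  obtains neg :: "'a \<Rightarrow> 'a" and meet join :: "'a \<Rightarrow> 'a \<Rightarrow> 'a" and k :: "cst \<Rightarrow> 'a"
  where "\<And>e. e \<in> eqns_over K \<Longrightarrow> holds neg meet join k e \<longleftrightarrow> derives K E e"
proof -
  interpret type_definition Rep Abs "(\<lambda>s. {t. derives K E (s \<approx> t)}) ` terms_over K"
    by (rule assms)
  define cls where "cls s = Abs {t. derives K E (s \<approx> t)}" for s
  have surj: "\<exists>t\<in>terms_over K. cls t = a" for a
    by (cases a) (auto simp: cls_def)
  have cls_eq: "cls s = cls t \<longleftrightarrow> derives K E (s \<approx> t)"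
    if "s \<in> terms_over K" "t \<in> terms_over K" for s t
    unfolding cls_def using that by (subst Abs_inject) (simp_all add: provable_class_eq_iff)
  obtain rep where rep: "\<And>a. rep a \<in> terms_over K" "\<And>a. cls (rep a) = a"
    using surj by metis
  define neg where "neg a = cls (\<^bold>\<not> rep a)" for a
  define meet where "meet a b = cls (rep a \<^bold>\<and> rep b)" for a b
  define join where "join a b = cls (rep a \<^bold>\<or> rep b)" for a b
  define k where "k c = cls (Cst c)" for c
  have rep_cls: "derives K E (rep (cls t) \<approx> t)" if "t \<in> terms_over K" for t
    using rep that cls_eq by blast
  \<comment> \<open>Evaluation in the quotient is substitution of chosen representatives, followed
    by passing to the class.\<close>
  have eval: "t \<in> terms_over K \<Longrightarrow> eval neg meet join k \<rho> t = cls (subst (\<lambda>n. rep (\<rho> n)) t)" for \<rho> t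
  proof (induction t)
    case (Neg t)
    then have t: "t \<in> terms_over K" by (simp add: terms_over_def)
    let ?t = "subst (\<lambda>n. rep (\<rho> n)) t"
    have mem: "?t \<in> terms_over K" using t rep by (simp add: subst_in_terms_over)
    have "cls (\<^bold>\<not> rep (cls ?t)) = cls (\<^bold>\<not> ?t)"
      using rep(1)[of "cls ?t"] mem
      by (subst cls_eq) (auto simp: terms_over_def intro!: derives.cong_Neg rep_cls)
    then show ?case using Neg.IH[OF t] by (simp add: neg_def)
  next
    case (And s t)
    then have st: "s \<in> terms_over K" "t \<in> terms_over K" by (simp_all add: terms_over_def)
    let ?s = "subst (\<lambda>n. rep (\<rho> n)) s" and ?t = "subst (\<lambda>n. rep (\<rho> n)) t"
    have mem: "?s \<in> terms_over K" "?t \<in> terms_over K" using st rep by (simp_all add: subst_in_terms_over)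
    have "cls (rep (cls ?s) \<^bold>\<and> rep (cls ?t)) = cls (?s \<^bold>\<and> ?t)"
      using rep(1)[of "cls ?s"] rep(1)[of "cls ?t"] mem
      by (subst cls_eq) (auto simp: terms_over_def intro!: derives.cong_And rep_cls)
    then show ?case using And.IH st by (simp add: meet_def)
  next
    case (Or s t)
    then have st: "s \<in> terms_over K" "t \<in> terms_over K" by (simp_all add: terms_over_def)
    let ?s = "subst (\<lambda>n. rep (\<rho> n)) s" and ?t = "subst (\<lambda>n. rep (\<rho> n)) t"
    have mem: "?s \<in> terms_over K" "?t \<in> terms_over K" using st rep by (simp_all add: subst_in_terms_over)
    have "cls (rep (cls ?s) \<^bold>\<or> rep (cls ?t)) = cls (?s \<^bold>\<or> ?t)"
      using rep(1)[of "cls ?s"] rep(1)[of "cls ?t"] mem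
      by (subst cls_eq) (auto simp: terms_over_def intro!: derives.cong_Or rep_cls)
    then show ?case using Or.IH st by (simp add: join_def)
  qed (use rep in \<open>simp_all add: k_def\<close>)
  have "holds neg meet join k e \<longleftrightarrow> derives K E e" if e: "e \<in> eqns_over K" for e
  proof -
    obtain s t where st: "e = (s \<approx> t)" "s \<in> terms_over K" "t \<in> terms_over K"
      using e by (auto simp: eqns_over_def)
    have iff: "eval neg meet join k \<rho> s = eval neg meet join k \<rho> t \<longleftrightarrow>
        derives K E (subst (\<lambda>n. rep (\<rho> n)) s \<approx> subst (\<lambda>n. rep (\<rho> n)) t)" for \<rho>
      using st rep by (simp add: eval cls_eq subst_in_terms_over)
    have "derives K E (s \<approx> t)" if "holds neg meet join k e"
    proof -
      \<comment> \<open>The generic valuation sends each variable to its own class; its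
        representative is provably equal to the variable, which recovers the original
        equation.\<close>
      define \<tau> where "\<tau> = (\<lambda>n. rep (cls (Var n)))"
      have "derives K E (\<tau> n \<approx> Var n)" for n
        by (simp add: \<tau>_def rep_cls terms_over_def)
      then have "derives K E (subst \<tau> s \<approx> s)" "derives K E (subst \<tau> t \<approx> t)"
        using derives_subst_cong[of K E \<tau> Var] st by (simp_all add: subst_Var)
      moreover have "derives K E (subst \<tau> s \<approx> subst \<tau> t)"
        using that iff[of "\<lambda>n. cls (Var n)"] st by (simp add: holds_def \<tau>_def)
      ultimately show ?thesis by (meson derives.sym derives.trans)
    qed
    then show ?thesis using iff derives.subst rep st by (fastforce simp: holds_def)
  qed
  then show ?thesis using that by blast
qed

section \<open>Complete axiomatisations\<close>

lemma axioms_in_eqns_over: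
  "CL \<subseteq> eqns_over K" "Mem1_group \<subseteq> eqns_over K" "Mem2_group \<subseteq> eqns_over K"
  by (auto simp: CL_def Mem1_group_def Mem2_group_def eqns_over_def terms_over_def ax_dneg_def
      ax_de_morgan_def ax_assoc_def ax_distrib_def ax_absorb_def ax_comm_def ax_Mem1_def ax_Mem2_def)

lemma const_axioms_in_eqns_over:
  "cU \<in> K \<Longrightarrow> ax_U \<in> eqns_over K"
  "cT \<in> K \<Longrightarrow> ax_T \<in> eqns_over K"
  "cT \<in> K \<Longrightarrow> cF \<in> K \<Longrightarrow> ax_TF \<in> eqns_over K"
  by (auto simp: eqns_over_def terms_over_def ax_U_def ax_T_def ax_TF_def)

text \<open>The signature without constants is enough: the axioms of \<open>CL\<close> contain none,
  and derivations persist in larger signatures. The same holds for the next type.\<close>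

typedef mem1_term =
  "(\<lambda>s. {t. derives {} Mem1_group (s \<approx> t)}) ` terms_over {}"
  unfolding terms_over_def by (auto intro: exI[of _ "\<^bold>x"])

typedef mem2_term =
  "(\<lambda>s. {t. derives {} Mem2_group (s \<approx> t)}) ` terms_over {}"
  unfolding terms_over_def by (auto intro: exI[of _ "\<^bold>x"])

lemma holds_Mem1_group_iff:
  "(\<forall>a\<in>Mem1_group. holds neg meet join k a) \<longleftrightarrow> mem1_algebra neg meet join"
  unfolding Mem1_group_def ball_simps holds_axiom_iff mem1_algebra_def mem1_algebra_axioms_def
    negation_algebra_def by blast

lemma Mem1_group_derives_CL:
  assumes "a \<in> CL"
  shows "derives {} Mem1_group a"
proof -
  obtain neg :: "mem1_term \<Rightarrow> mem1_term" and meet join ::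
      "mem1_term \<Rightarrow> mem1_term \<Rightarrow> mem1_term"
      and k :: "cst \<Rightarrow> mem1_term"
    where eq: "\<And>e. e \<in> eqns_over {} \<Longrightarrow>
      holds neg meet join k e \<longleftrightarrow> derives {} Mem1_group e"
    by (rule term_algebra[OF type_definition_mem1_term]) (rule that)
  have "\<forall>a\<in>Mem1_group. holds neg meet join k a"
    using eq axioms_in_eqns_over(2) by (blast intro: derives.axiom)
  then interpret mem1_algebra neg meet join
    unfolding holds_Mem1_group_iff .
  have "holds neg meet join k a"
    using assms dneg de_morgan absorb comm assoc distrib Mem2
    by (auto simp: CL_def holds_axiom_iff)
  then show ?thesis using eq assms axioms_in_eqns_over(1) by blast
qed

lemma holds_Mem2_group_iff:
  "(\<forall>a\<in>Mem2_group. holds neg meet join k a) \<longleftrightarrow> mem2_algebra neg meet join"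
  unfolding Mem2_group_def ball_simps holds_axiom_iff mem2_algebra_def mem2_algebra_axioms_def
    negation_algebra_def by blast

lemma Mem2_group_derives_CL:
  assumes "a \<in> CL"
  shows "derives {} Mem2_group a"
proof -
  obtain neg :: "mem2_term \<Rightarrow> mem2_term" and meet join ::
      "mem2_term \<Rightarrow> mem2_term \<Rightarrow> mem2_term"
      and k :: "cst \<Rightarrow> mem2_term"
    where eq: "\<And>e. e \<in> eqns_over {} \<Longrightarrow>
      holds neg meet join k e \<longleftrightarrow> derives {} Mem2_group e"
    by (rule term_algebra[OF type_definition_mem2_term]) (rule that)
  have "\<forall>a\<in>Mem2_group. holds neg meet join k a"
    using eq axioms_in_eqns_over(3) by (blast intro: derives.axiom)
  then interpret mem2_algebra neg meet join
    unfolding holds_Mem2_group_iff .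
  have "holds neg meet join k a"
    using assms dneg de_morgan absorb comm assoc distrib mem
    by (auto simp: CL_def holds_axiom_iff)
  then show ?thesis using eq assms axioms_in_eqns_over(1) by blast
qed

text \<open>The two memory axioms differ by one rebracketing, which is associativity with \<sim> x
  for x.\<close>

lemma CL_derives_Mem1: "derives {} CL ax_Mem1"
proof -
  have Mem2: "derives {} CL ax_Mem2" and assoc: "derives {} CL ax_assoc"
    by (simp_all add: CL_def derives.axiom)
  have "derives {} CL (((\<^bold>\<not> \<^bold>x) \<^bold>\<and> \<^bold>y) \<^bold>\<and> \<^bold>z \<approx> (\<^bold>\<not> \<^bold>x) \<^bold>\<and> (\<^bold>y \<^bold>\<and> \<^bold>z))"
    using derives.subst[OF assoc[unfolded ax_assoc_def], of "Var(0 := \<^bold>\<not> \<^bold>x)"]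
    by (simp add: terms_over_def)
  moreover have "derives {} CL (\<^bold>x \<^bold>\<and> \<^bold>z \<approx> \<^bold>x \<^bold>\<and> \<^bold>z)"
    by (simp add: derives.refl terms_over_def)
  ultimately show ?thesis
    using derives.trans[OF Mem2[unfolded ax_Mem2_def]] derives.cong_Or
    unfolding ax_Mem1_def by blast
qed

text \<open>One equivalence of \<open>A\<close> and \<open>E\<close> without constants serves all
  signatures, since the constant axioms \<open>X\<close> stand on both sides.\<close>

lemma completely_axiomatisesI:
  assumes "A \<subseteq> eqns_over K" "E \<subseteq> eqns_over K"
    and "\<And>a. a \<in> A \<Longrightarrow> derives {} E a" "\<And>a. a \<in> E \<Longrightarrow> derives {} A a" "X \<subseteq> eqns_over K"
  shows "completely_axiomatises K (A \<union> X) (X \<union> E)"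
  unfolding completely_axiomatises_def
proof (intro conjI ballI iffI)
  show "X \<union> E \<subseteq> eqns_over K" using assms by blast
next
  fix e assume "derives K (X \<union> E) e"
  moreover have "derives K (A \<union> X) a" if "a \<in> X \<union> E" for a
    using that derives_mono[OF assms(4), of a K "A \<union> X"] derives.axiom[of a "A \<union> X" K] by auto
  ultimately show "derives K (A \<union> X) e" by (blast intro: derives_cut)
next
  fix e assume "derives K (A \<union> X) e"
  moreover have "derives K (X \<union> E) a" if "a \<in> A \<union> X" for a
    using that derives_mono[OF assms(3), of a K "X \<union> E"] derives.axiom[of a "X \<union> E" K] by auto
  ultimately show "derives K (X \<union> E) e" by (blast intro: derives_cut)
qed

lemma completely_axiomatises_Mem1_group:
  assumes "X \<subseteq> eqns_over K"
  shows "completely_axiomatises K (CL \<union> X) (X \<union> Mem1_group)"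
proof (rule completely_axiomatisesI)
  show "derives {} CL a" if "a \<in> Mem1_group" for a
    using that CL_derives_Mem1 by (auto simp: Mem1_group_def CL_def intro: derives.axiom)
qed (use assms axioms_in_eqns_over Mem1_group_derives_CL in auto)

lemma completely_axiomatises_Mem2_group:
  assumes "X \<subseteq> eqns_over K"
  shows "completely_axiomatises K (CL \<union> X) (X \<union> Mem2_group)"
proof (rule completely_axiomatisesI)
  show "derives {} CL a" if "a \<in> Mem2_group" for a
    using that by (auto simp: Mem2_group_def CL_def intro: derives.axiom)
qed (use assms axioms_in_eqns_over Mem2_group_derives_CL in auto)

section \<open>Independence\<close>

lemma not_derivable:
  assumes "\<forall>a\<in>E. holds neg meet join k a" and "\<not> holds neg meet join k e"
  shows "\<not> derives K E e"
  using assms soundness by blast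

lemma not_derives_antimono: "\<not> derives K E' e \<Longrightarrow> E \<subseteq> E' \<Longrightarrow> \<not> derives K E e"
  using derives_mono by blast

lemma independent_axioms_antimono:
  "independent_axioms K' E' \<Longrightarrow> K \<subseteq> K' \<Longrightarrow> E \<subseteq> E' \<Longrightarrow> independent_axioms K E"
  unfolding independent_axioms_def using derives_mono[where K = K and K' = K']
  by (metis Diff_mono in_mono order_refl)

text \<open>A countermodel for one axiom among all of these serves both groups. For (Mem1), (Mem2)
  and distributivity this is impossible, as each follows from the group without it; their models
  drop a second axiom.\<close>

definition all_axioms :: "eqn set" where
  "all_axioms = {ax_U, ax_T, ax_TF} \<union> Mem1_group \<union> Mem2_group"

lemmas all_axioms_simps = all_axioms_def Mem1_group_def Mem2_group_def holds_axiom_iff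

text \<open>Sequential (left to right) connectives; an undefined left operand is absorbing.
  For one undefined value these are the connectives of the algebra \<open>C\<close> of Guzman and Squier.\<close>

primrec seq_neg :: "bool + 'u \<Rightarrow> bool + 'u" where
  "seq_neg (Inl b) = Inl (\<not> b)"
| "seq_neg (Inr u) = Inr u"

primrec seq_and :: "bool + 'u \<Rightarrow> bool + 'u \<Rightarrow> bool + 'u" where
  "seq_and (Inl b) y = (if b then y else Inl False)"
| "seq_and (Inr u) y = Inr u"

primrec seq_or :: "bool + 'u \<Rightarrow> bool + 'u \<Rightarrow> bool + 'u" where
  "seq_or (Inl b) y = (if b then Inl True else y)"
| "seq_or (Inr u) y = Inr u"

section \<open>Countermodels\<close>

lemma ax_U_underivable: "\<not> derives K (all_axioms - {ax_U}) ax_U"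
  by (rule not_derivable[where neg = Not and meet = "(\<and>)" and join = "(\<or>)" and
        k = "case_cst True False True"])
    (auto simp: all_axioms_simps)

lemma ax_T_underivable: "\<not> derives K (all_axioms - {ax_T}) ax_T"
  by (rule not_derivable[where neg = seq_neg and meet = seq_and and join = seq_or and
        k = "\<lambda>_. Inr ()"])
    (auto simp: all_axioms_simps split_sum_all all_bool_eq)

lemma ax_TF_underivable: "\<not> derives K (all_axioms - {ax_TF}) ax_TF"
  by (rule not_derivable[where neg = seq_neg and meet = seq_and and join = seq_or and
        k = "case_cst (Inl True) (Inr ()) (Inr ())"])
    (auto simp: all_axioms_simps split_sum_all all_bool_eq)

text \<open>With the left projection as disjunction, absorption, distributivity and both memory
  axioms become trivial, and \<open>ax_comm\<close> says that conjunction commutes. The constant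
  negation still satisfies De Morgan.\<close>

lemma ax_dneg_underivable: "\<not> derives K (all_axioms - {ax_dneg}) ax_dneg"
  by (rule not_derivable[where neg = "\<lambda>_. False" and meet = "(\<and>)" and join = "\<lambda>x _. x" and
        k = "case_cst True False False"])
    (auto simp: all_axioms_simps)

lemma ax_de_morgan_underivable: "\<not> derives K (all_axioms - {ax_de_morgan}) ax_de_morgan"
  by (rule not_derivable[where neg = "\<lambda>x. x" and meet = "(\<and>)" and join = "\<lambda>x _. x" and
        k = "\<lambda>_. True"])
    (auto simp: all_axioms_simps)

text \<open>In a semilattice with unit, an equation holds as soon as both sides have the same
  variables. Absorption is the only axiom where they differ.\<close>

lemma ax_absorb_underivable: "\<not> derives K (all_axioms - {ax_absorb}) ax_absorb"
  by (rule not_derivable[where neg = "\<lambda>x. x" and meet = "(\<and>)" and join = "(\<and>)" and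
        k = "\<lambda>_. True"])
    (auto simp: all_axioms_simps)

text \<open>Two distinct undefined values u and v suffice: the two sides evaluate to u and to
  v.\<close>

lemma ax_comm_underivable: "\<not> derives K (all_axioms - {ax_comm}) ax_comm"
  by (rule not_derivable[where neg = seq_neg and meet = seq_and and join = seq_or and
        k = "case_cst (Inl True) (Inl False) (Inr True)"])
    (auto simp: all_axioms_simps split_sum_all split_sum_ex all_bool_eq ex_bool_eq)

text \<open>Belnap's four-valued logic.\<close>

lemma memory_axiom_underivable:
  assumes "e \<in> {ax_Mem1, ax_Mem2}"
  shows "\<not> derives K (all_axioms - {ax_Mem1, ax_Mem2}) e"
  \<comment> \<open>A pair records evidence for and against. Both memory axioms fail when x has
    neither and y, z are true: the left side is true, the right side is x.\<close>
  by (rule not_derivable[where neg = prod.swap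
        and meet = "\<lambda>(a, b) (c, d). (a \<and> c, b \<or> d)" and join = "\<lambda>(a, b) (c, d). (a \<or> c, b \<and> d)"
        and k = "case_cst (True, False) (False, True) (True, True)"])
    (use assms in \<open>auto simp: all_axioms_simps all_bool_eq\<close>)

text \<open>A truth value other than the undefined one consists of a set of two marks and a sign.
  A sequential connective collects the marks, and the sign flips when the sets of marks of its
  two operands are the two different singletons.\<close>

fun twist_and :: "(bool \<times> bool \<times> bool) option \<Rightarrow> (bool \<times> bool \<times> bool) option \<Rightarrow>
    (bool \<times> bool \<times> bool) option" where
  "twist_and None y = None"
| "twist_and (Some (i, j, False)) y = Some (i, j, False)"
| "twist_and (Some (i, j, True)) None = None"
| "twist_and (Some (i, j, True)) (Some (i', j', b)) =
    Some (i \<or> i', j \<or> j', b \<noteq> (i \<noteq> j \<and> i' = j \<and> j' = i))"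

fun twist_or :: "(bool \<times> bool \<times> bool) option \<Rightarrow> (bool \<times> bool \<times> bool) option \<Rightarrow>
    (bool \<times> bool \<times> bool) option" where
  "twist_or None y = None"
| "twist_or (Some (i, j, True)) y = Some (i, j, True)"
| "twist_or (Some (i, j, False)) None = None"
| "twist_or (Some (i, j, False)) (Some (i', j', b)) =
    Some (i \<or> i', j \<or> j', b \<noteq> (i \<noteq> j \<and> i' = j \<and> j' = i))"

primrec twist_neg :: "(bool \<times> bool \<times> bool) option \<Rightarrow> (bool \<times> bool \<times> bool) option" where
  "twist_neg None = None"
| "twist_neg (Some p) = (case p of (i, j, b) \<Rightarrow> Some (i, j, \<not> b))"

lemma twist_laws:
  "\<forall>x. twist_neg (twist_neg x) = x"
  "\<forall>x y. twist_neg (twist_and x y) = twist_or (twist_neg x) (twist_neg y)"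
  "\<forall>x y. twist_or x (twist_and x y) = x"
  "\<forall>x y. twist_or (twist_and x y) (twist_and y x) = twist_or (twist_and y x) (twist_and x y)"
  "\<forall>x y z. twist_and (twist_or x y) z =
    twist_or (twist_and x z) (twist_and (twist_and (twist_neg x) y) z)"
  "\<forall>x. twist_and (Some (False, False, True)) x = x"
  by (simp_all add: split_option_all all_bool_eq)

lemma ax_distrib_underivable: "\<not> derives K (all_axioms - {ax_Mem1, ax_distrib}) ax_distrib"
proof (rule not_derivable)
  let ?k = "case_cst (Some (False, False, True)) (Some (False, False, False)) None"
  have "\<forall>a\<in>{ax_U, ax_T, ax_TF, ax_dneg, ax_de_morgan, ax_Mem2, ax_absorb, ax_comm}.
      holds twist_neg twist_and twist_or ?k a"
    unfolding ball_simps holds_axiom_iff cst.case by (intro conjI twist_laws) simp_all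
  moreover have "all_axioms - {ax_Mem1, ax_distrib} \<subseteq>
      {ax_U, ax_T, ax_TF, ax_dneg, ax_de_morgan, ax_Mem2, ax_absorb, ax_comm}"
    by (auto simp: all_axioms_def Mem1_group_def Mem2_group_def)
  ultimately show "\<forall>a\<in>all_axioms - {ax_Mem1, ax_distrib}. holds twist_neg twist_and twist_or ?k a"
    by (meson subsetD)
  show "\<not> holds twist_neg twist_and twist_or ?k ax_distrib"
    unfolding holds_axiom_iff
  proof
    assume "\<forall>x y z. twist_and x (twist_or y z) = twist_or (twist_and x y) (twist_and x z)"
    \<comment> \<open>The disjunction of y and z is y, and conjoining x with it flips the sign to a
      defined false value. On the right that false value no longer shields the undefined second
      disjunct.\<close>
    from this[rule_format, of "Some (False, True, True)" "Some (True, False, False)" None]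
    show False by simp
  qed
qed

lemma single_axiom_underivable:
  assumes "e \<in> {ax_U, ax_T, ax_TF, ax_dneg, ax_de_morgan, ax_absorb, ax_comm}"
  shows "\<not> derives K (all_axioms - {e}) e"
  using assms ax_U_underivable ax_T_underivable ax_TF_underivable ax_dneg_underivable
    ax_de_morgan_underivable ax_absorb_underivable ax_comm_underivable by blast

lemmas axiom_defs = ax_dneg_def ax_de_morgan_def ax_distrib_def ax_absorb_def ax_comm_def
  ax_Mem1_def ax_Mem2_def ax_U_def ax_T_def ax_TF_def

section \<open>Independence of the two largest groups\<close>

lemma independent_axioms_Mem1_group:
  "independent_axioms K ({ax_U, ax_T, ax_TF} \<union> Mem1_group)" (is "independent_axioms K ?E")
  unfolding independent_axioms_def
proof
  fix e assume e: "e \<in> ?E"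
  show "\<not> derives K (?E - {e}) e"
  proof (cases "e = ax_Mem1")
    case True
    \<comment> \<open>Belnap's algebra falsifies both memory axioms, so (Mem2) must be absent from
      the remaining axioms.\<close>
    have "ax_Mem2 \<notin> ?E"
      by (simp add: Mem1_group_def axiom_defs)
    then have "?E - {e} \<subseteq> all_axioms - {ax_Mem1, ax_Mem2}"
      using True by (auto simp: all_axioms_def)
    then show ?thesis
      unfolding True by (rule not_derives_antimono[OF memory_axiom_underivable, rotated]) simp
  next
    case False
    then have "e \<in> {ax_U, ax_T, ax_TF, ax_dneg, ax_de_morgan, ax_absorb, ax_comm}"
      using e by (auto simp: Mem1_group_def)
    moreover have "?E - {e} \<subseteq> all_axioms - {e}"
      by (auto simp: all_axioms_def)
    ultimately show ?thesis
      by (rule not_derives_antimono[OF single_axiom_underivable])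
  qed
qed

lemma independent_axioms_Mem2_group:
  "independent_axioms K ({ax_U, ax_T, ax_TF} \<union> Mem2_group)" (is "independent_axioms K ?E")
  unfolding independent_axioms_def
proof
  fix e assume e: "e \<in> ?E"
  consider "e = ax_Mem2" | "e = ax_distrib" |
      "e \<in> {ax_U, ax_T, ax_TF, ax_dneg, ax_de_morgan, ax_absorb, ax_comm}"
    using e by (auto simp: Mem2_group_def)
  moreover have Mem1: "ax_Mem1 \<notin> ?E"
    by (simp add: Mem2_group_def axiom_defs)
  ultimately show "\<not> derives K (?E - {e}) e"
  proof cases
    case 1
    have "?E - {e} \<subseteq> all_axioms - {ax_Mem1, ax_Mem2}"
      using 1 Mem1 by (auto simp: all_axioms_def)
    then show ?thesis
      unfolding 1 by (rule not_derives_antimono[OF memory_axiom_underivable, rotated]) simp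
  next
    case 2
    have "?E - {e} \<subseteq> all_axioms - {ax_Mem1, ax_distrib}"
      using 2 Mem1 by (auto simp: all_axioms_def)
    then show ?thesis
      unfolding 2 by (rule not_derives_antimono[OF ax_distrib_underivable])
  next
    case 3
    moreover have "?E - {e} \<subseteq> all_axioms - {e}"
      by (auto simp: all_axioms_def)
    ultimately show ?thesis
      by (rule not_derives_antimono[OF single_axiom_underivable])
  qed
qed

theorem theorem5p1:
  shows
    "(completely_axiomatises {} CL Mem1_group \<and> independent_axioms {} Mem1_group) \<and>
     (completely_axiomatises {} CL Mem2_group \<and> independent_axioms {} Mem2_group) \<and>
     (completely_axiomatises {cT, cF} CL\<^sub>2 ({ax_T, ax_TF} \<union> Mem1_group) \<and>
      completely_axiomatises {cT, cF} CL\<^sub>2 ({ax_T, ax_TF} \<union> Mem2_group) \<and>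
      independent_axioms {cT, cF} ({ax_T, ax_TF} \<union> Mem1_group) \<and>
      independent_axioms {cT, cF} ({ax_T, ax_TF} \<union> Mem2_group)) \<and>
     (completely_axiomatises {cU} CL\<^sub>U ({ax_U} \<union> Mem1_group) \<and>
      completely_axiomatises {cU} CL\<^sub>U ({ax_U} \<union> Mem2_group) \<and>
      independent_axioms {cU} ({ax_U} \<union> Mem1_group) \<and>
      independent_axioms {cU} ({ax_U} \<union> Mem2_group)) \<and>
     (completely_axiomatises {cT, cF, cU} CL\<^sub>3 ({ax_U, ax_T, ax_TF} \<union> Mem1_group) \<and>
      completely_axiomatises {cT, cF, cU} CL\<^sub>3 ({ax_U, ax_T, ax_TF} \<union> Mem2_group) \<and>
      independent_axioms {cT, cF, cU} ({ax_U, ax_T, ax_TF} \<union> Mem1_group) \<and>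
      independent_axioms {cT, cF, cU} ({ax_U, ax_T, ax_TF} \<union> Mem2_group))"
proof -
  have complete: "completely_axiomatises K (CL \<union> X) (X \<union> Mem1_group)"
    "completely_axiomatises K (CL \<union> X) (X \<union> Mem2_group)" if "X \<subseteq> eqns_over K" for K X
    using that completely_axiomatises_Mem1_group completely_axiomatises_Mem2_group by blast+
  have independent: "independent_axioms K (X \<union> Mem1_group)" "independent_axioms K (X \<union> Mem2_group)"
    if "X \<subseteq> {ax_U, ax_T, ax_TF}" for K X
    using that independent_axioms_antimono[OF independent_axioms_Mem1_group[of K], of K "X \<union> Mem1_group"]
      independent_axioms_antimono[OF independent_axioms_Mem2_group[of K], of K "X \<union> Mem2_group"] by blast+
  have CL\<^sub>3: "CL\<^sub>3 = CL \<union> {ax_U, ax_T, ax_TF}"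
    by (auto simp: CL\<^sub>3_def)
  show ?thesis
    unfolding CL\<^sub>2_def CL\<^sub>U_def CL\<^sub>3
    using complete[of "{}" "{}"] independent[of "{}" "{}"]
    by (intro conjI complete independent) (simp_all add: const_axioms_in_eqns_over)
qed

end
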